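(* Let $(\Omega,M)$ be a finite transformation monoid and let $\mu$ be a probability distribution on $M$ such that $\langle\mathrm{supp}(\mu)\rangle$ is transitive on $\Omega$. Let $P$ be the transition matrix of the irreducible Markov chain with state set $\Omega$ defined by $$P(\alpha,\beta)=\sum_{m\in M,\ \alpha m=\beta}\mu(m)\qquad(\alpha,\beta\in\Omega),$$ and let $\pi$ be the stationary distribution of $P$. Let $s\in I(M)$ and suppose that $\ker s=\{B_1,\ldots,B_r\}$. Then $|\Omega s|\cdot\pi(B_i)=1$ for $i=1,\ldots,r$. In particular, $\ker s$ is $\pi$-uniform.
   Context: A transformation monoid $(\Omega,M)$ is a non-empty set $\Omega$ with a submonoid $M$ of the monoid of all self-maps of $\Omega$, acting on the right; it is finite if $\Omega$ is finite. $\langle A\rangle$ denotes the submonoid of $M$ generated by $A$; a submonoid $N$ is transitive on $\Omega$ if $\alpha N=\Omega$ for all $\alpha\in\Omega$. $I(M)$ is the unique minimal two-sided ideal of the finite monoid $M$. $\ker s$ is the partition of $\Omega$ into the non-empty fibres of the map $\omega\mapsto\omega s$. A probability distribution on a finite set $X$ is a function $\mu\colon X\to[0,1]$ with $\sum_{x\in X}\mu(x)=1$; $\mathrm{supp}(\mu)=\{x\mid\mu(x)\neq0\}$ and $\mu(A)=\sum_{x\in A}\mu(x)$ for $A\subseteq X$. A partition $\{P_1,\dots,P_r\}$ of $\Omega$ is $\pi$-uniform if $\pi(P_1)=\cdots=\pi(P_r)$. A distribution $\pi$ on $\Omega$ is stationary for $P$ if $\pi P=\pi$, where $(\pi P)(\alpha)=\sum_{\omega\in\Omega}\pi(\omega)P(\omega,\alpha)$.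 Under the transitivity hypothesis the chain is irreducible and has a unique stationary distribution. *)

theory Defs
  imports
    "HOL-Algebra.Group"
    "HOL-Library.Disjoint_Sets"
    "HOL-Probability.Probability_Mass_Function"
begin

text \<open>Maps act on the right: the product of \<open>f\<close> and \<open>g\<close> is ``first \<open>f\<close>, then \<open>g\<close>'', so that
  \<open>\<omega>(fg) = (\<omega>f)g\<close>. Self-maps of \<open>\<Omega>\<close> are represented by functions that are \<open>undefined\<close> outside
  \<open>\<Omega>\<close>, so that equal maps are equal functions.\<close>

definition self_maps :: "'a set \<Rightarrow> ('a \<Rightarrow> 'a) monoid" where
  "self_maps \<Omega> =
    \<lparr>carrier = \<Omega> \<rightarrow>\<^sub>E \<Omega>, monoid.mult = (\<lambda>f g. compose \<Omega> g f), one = restrict id \<Omega>\<rparr>"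

lemma monoid_self_maps: "monoid (self_maps \<Omega>)"
proof (rule monoidI)
  fix f g h
  assume *: "f \<in> carrier (self_maps \<Omega>)" "g \<in> carrier (self_maps \<Omega>)"
    "h \<in> carrier (self_maps \<Omega>)"
  then have "\<And>x. x \<in> \<Omega> \<Longrightarrow> f x \<in> \<Omega>"
    by (auto simp: self_maps_def)
  then show "f \<otimes>\<^bsub>self_maps \<Omega>\<^esub> g \<otimes>\<^bsub>self_maps \<Omega>\<^esub> h =
    f \<otimes>\<^bsub>self_maps \<Omega>\<^esub> (g \<otimes>\<^bsub>self_maps \<Omega>\<^esub> h)"
    by (simp add: self_maps_def compose_def fun_eq_iff)
next
  fix f g
  assume "f \<in> carrier (self_maps \<Omega>)" "g \<in> carrier (self_maps \<Omega>)"
  then show "f \<otimes>\<^bsub>self_maps \<Omega>\<^esub> g \<in> carrier (self_maps \<Omega>)"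
    by (auto simp: self_maps_def compose_def)
next
  fix f
  assume "f \<in> carrier (self_maps \<Omega>)"
  then have f: "\<And>x. x \<in> \<Omega> \<Longrightarrow> f x \<in> \<Omega>" "f \<in> extensional \<Omega>"
    by (auto simp: self_maps_def PiE_def)
  show "\<one>\<^bsub>self_maps \<Omega>\<^esub> \<otimes>\<^bsub>self_maps \<Omega>\<^esub> f = f"
    using f by (simp add: self_maps_def compose_def extensional_def fun_eq_iff)
  show "f \<otimes>\<^bsub>self_maps \<Omega>\<^esub> \<one>\<^bsub>self_maps \<Omega>\<^esub> = f"
    using f by (simp add: self_maps_def compose_def extensional_def fun_eq_iff)
qed (simp add: self_maps_def)

definition transformation_monoid :: "'a set \<Rightarrow> ('a \<Rightarrow> 'a) set \<Rightarrow> bool" where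
  "transformation_monoid \<Omega> M \<longleftrightarrow> \<Omega> \<noteq> {} \<and> submonoid M (self_maps \<Omega>)"

definition monoid_of :: "'a set \<Rightarrow> ('a \<Rightarrow> 'a) set \<Rightarrow> ('a \<Rightarrow> 'a) monoid" where
  "monoid_of \<Omega> M = (self_maps \<Omega>)\<lparr>carrier := M\<rparr>"

lemma monoid_monoid_of:
  assumes "transformation_monoid \<Omega> M"
  shows "monoid (monoid_of \<Omega> M)"
  unfolding monoid_of_def
  using assms submonoid.submonoid_is_monoid[OF _ monoid_self_maps]
  unfolding transformation_monoid_def by blast

lemma finite_monoid_of:
  assumes "transformation_monoid \<Omega> M" and "finite \<Omega>"
  shows "finite (carrier (monoid_of \<Omega> M))"
proof -
  have "M \<subseteq> \<Omega> \<rightarrow>\<^sub>E \<Omega>"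
    using assms(1) submonoid.subset
    by (fastforce simp: transformation_monoid_def self_maps_def)
  then show ?thesis
    using assms(2) by (auto simp: monoid_of_def intro: finite_subset finite_PiE)
qed

definition generated_submonoid :: "('a, 'b) monoid_scheme \<Rightarrow> 'a set \<Rightarrow> 'a set" where
  "generated_submonoid G A = (\<lambda>N. submonoid N G) hull A"

definition transitive_maps :: "'a set \<Rightarrow> ('a \<Rightarrow> 'a) set \<Rightarrow> bool" where
  "transitive_maps \<Omega> N \<longleftrightarrow> (\<forall>\<alpha>\<in>\<Omega>. (\<lambda>f. f \<alpha>) ` N = \<Omega>)"

text \<open>Ideals of a monoid are non-empty; otherwise the minimal ideal would always be empty.\<close>

definition two_sided_ideal :: "'a set \<Rightarrow> ('a, 'b) monoid_scheme \<Rightarrow> bool" where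
  "two_sided_ideal I G \<longleftrightarrow> I \<noteq> {} \<and> I \<subseteq> carrier G \<and>
    (\<forall>x\<in>I. \<forall>m\<in>carrier G. x \<otimes>\<^bsub>G\<^esub> m \<in> I \<and> m \<otimes>\<^bsub>G\<^esub> x \<in> I)"

definition is_minimal_ideal :: "'a set \<Rightarrow> ('a, 'b) monoid_scheme \<Rightarrow> bool" where
  "is_minimal_ideal I G \<longleftrightarrow>
    two_sided_ideal I G \<and> (\<forall>J. two_sided_ideal J G \<longrightarrow> J \<subseteq> I \<longrightarrow> J = I)"

definition minimal_ideal :: "('a, 'b) monoid_scheme \<Rightarrow> 'a set" where
  "minimal_ideal G = (THE I. is_minimal_ideal I G)"

lemma ex1_minimal_ideal:
  assumes "monoid G" and fin: "finite (carrier G)"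
  shows "\<exists>!I. is_minimal_ideal I G"
proof -
  interpret monoid G by fact
  have "two_sided_ideal (carrier G) G"
    by (auto simp: two_sided_ideal_def)
  moreover have "finite {I. two_sided_ideal I G}"
    by (rule finite_subset[of _ "Pow (carrier G)"]) (auto simp: two_sided_ideal_def fin)
  ultimately obtain I where "two_sided_ideal I G"
    and "\<And>J. two_sided_ideal J G \<Longrightarrow> J \<subseteq> I \<Longrightarrow> J = I"
    using finite_has_minimal[of "{I. two_sided_ideal I G}"] by auto
  then have ex: "is_minimal_ideal I G"
    by (auto simp: is_minimal_ideal_def)
  have "I = J" if "is_minimal_ideal I G" "is_minimal_ideal J G" for I J
  proof -
    have I: "two_sided_ideal I G" "\<And>K. two_sided_ideal K G \<Longrightarrow> K \<subseteq> I \<Longrightarrow> K = I"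
      and J: "two_sided_ideal J G" "\<And>K. two_sided_ideal K G \<Longrightarrow> K \<subseteq> J \<Longrightarrow> K = J"
      using that unfolding is_minimal_ideal_def by blast+
    obtain x y where "x \<in> I" "y \<in> J"
      using I(1) J(1) unfolding two_sided_ideal_def by blast
    then have "x \<otimes>\<^bsub>G\<^esub> y \<in> I \<inter> J"
      using I(1) J(1) unfolding two_sided_ideal_def by blast
    then have "two_sided_ideal (I \<inter> J) G"
      using I(1) J(1) unfolding two_sided_ideal_def by blast
    then show ?thesis
      using I(2) J(2) by (metis inf_le1 inf_le2)
  qed
  with ex show ?thesis by blast
qed

lemma is_minimal_ideal_minimal_ideal:
  assumes "monoid G" and "finite (carrier G)"
  shows "is_minimal_ideal (minimal_ideal G) G"
  unfolding minimal_ideal_def using ex1_minimal_ideal[OF assms] by (rule theI')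

definition ker_partition :: "'a set \<Rightarrow> ('a \<Rightarrow> 'a) \<Rightarrow> 'a set set" where
  "ker_partition \<Omega> s = (\<lambda>\<beta>. {\<omega> \<in> \<Omega>. s \<omega> = \<beta>}) ` (s ` \<Omega>)"

text \<open>A probability distribution on a finite set \<open>X\<close> is a \<open>pmf\<close> whose support lies in \<open>X\<close>.\<close>

definition transition_matrix ::
    "('a \<Rightarrow> 'a) set \<Rightarrow> ('a \<Rightarrow> 'a) pmf \<Rightarrow> 'a \<Rightarrow> 'a \<Rightarrow> real" where
  "transition_matrix M \<mu> \<alpha> \<beta> = (\<Sum>m | m \<in> M \<and> m \<alpha> = \<beta>. pmf \<mu> m)"

definition stationary_distribution ::
    "'a set \<Rightarrow> ('a \<Rightarrow> 'a \<Rightarrow> real) \<Rightarrow> 'a pmf \<Rightarrow> bool" where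
  "stationary_distribution \<Omega> P \<pi> \<longleftrightarrow> set_pmf \<pi> \<subseteq> \<Omega> \<and>
    (\<forall>\<alpha>\<in>\<Omega>. (\<Sum>\<omega>\<in>\<Omega>. pmf \<pi> \<omega> * P \<omega> \<alpha>) = pmf \<pi> \<alpha>)"

definition uniform_partition :: "'a set \<Rightarrow> 'a pmf \<Rightarrow> 'a set set \<Rightarrow> bool" where
  "uniform_partition \<Omega> \<pi> \<P> \<longleftrightarrow> partition_on \<Omega> \<P> \<and>
    (\<forall>A\<in>\<P>. \<forall>B\<in>\<P>. measure_pmf.prob \<pi> A = measure_pmf.prob \<pi> B)"

end

theory Submission
  imports Defs
begin

text \<open>
  Write \<open>T = \<Omega>s\<close>, let \<open>B\<close> be a block of \<open>ker s\<close>, and let \<open>P\<close> act on functions \<open>f\<close> by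
  \<open>(Pf)(\<alpha>) = \<Sum>m. \<mu>(m) f(\<alpha>m)\<close>.

  The algebraic input is that all elements of the minimal ideal have the same rank
  (\<open>rank_constant_on_minimal_ideal\<close>). Hence \<open>sms\<close> has the same rank as \<open>s\<close> for every \<open>m \<in> M\<close>, so
  every translate \<open>Tm\<close> of the image is a transversal of \<open>ker s\<close>: it meets \<open>B\<close> in exactly one point
  (\<open>image_translate_meets_block_once\<close>). So the function \<open>f = 1\<^sub>B\<close> has sum \<open>1\<close> over each translate
  \<open>Tm\<close>, and this property passes from \<open>f\<close> to \<open>Pf\<close>, whereas the integral of \<open>f\<close> against \<open>\<pi>\<close> is
  preserved by \<open>P\<close> because \<open>\<pi>\<close> is stationary.

  The analytic input is that averages of the iterates \<open>P\<^sup>k 1\<^sub>B\<close> accumulate at a function \<open>h\<close> with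
  \<open>Ph = h\<close> (\<open>cesaro_averages_accumulate_at_harmonic\<close>), and by transitivity and the maximum
  principle \<open>h\<close> is a constant \<open>c\<close> (\<open>harmonic_imp_constant\<close>). Both linear invariants survive the
  passage to the limit: summing over \<open>T\<close> gives \<open>\<bar>T\<bar> c = 1\<close>, and integrating against \<open>\<pi>\<close> gives
  \<open>c = \<pi>(B)\<close>.

  The rank comparison has to take place in \<open>M\<close>: the submonoid generated by the support of \<open>\<mu>\<close> may
  be a permutation group and so need not meet the minimal ideal of \<open>M\<close>.
\<close>

section \<open>Rank and transversals in the minimal ideal\<close>

lemma transformation_monoidD:
  assumes "transformation_monoid \<Omega> M"
  shows "\<Omega> \<noteq> {}" and "M \<subseteq> \<Omega> \<rightarrow>\<^sub>E \<Omega>" and "restrict id \<Omega> \<in> M"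
    and "\<And>f g. f \<in> M \<Longrightarrow> g \<in> M \<Longrightarrow> compose \<Omega> g f \<in> M"
proof -
  have sub: "submonoid M (self_maps \<Omega>)" and "\<Omega> \<noteq> {}"
    using assms by (auto simp: transformation_monoid_def)
  show "\<Omega> \<noteq> {}" by fact
  show "M \<subseteq> \<Omega> \<rightarrow>\<^sub>E \<Omega>"
    using submonoid.subset[OF sub] by (simp add: self_maps_def)
  show "restrict id \<Omega> \<in> M"
    using submonoid.one_closed[OF sub] by (simp add: self_maps_def)
  show "compose \<Omega> g f \<in> M" if "f \<in> M" "g \<in> M" for f g
    using submonoid.m_closed[OF sub that] by (simp add: self_maps_def)
qed

lemma monoid_of_simps:
  "carrier (monoid_of \<Omega> M) = M"
  "f \<otimes>\<^bsub>monoid_of \<Omega> M\<^esub> g = compose \<Omega> g f"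
  "\<one>\<^bsub>monoid_of \<Omega> M\<^esub> = restrict id \<Omega>"
  by (simp_all add: monoid_of_def self_maps_def)

lemma finite_transformation_monoid:
  assumes "transformation_monoid \<Omega> M" and "finite \<Omega>"
  shows "finite M"
  using finite_monoid_of[OF assms] by (simp add: monoid_of_simps)

text \<open>Multiplication on either side cannot increase the rank, so within a minimal ideal the elements
  of least rank form an ideal, which by minimality is everything.\<close>

lemma rank_constant_on_minimal_ideal:
  assumes M: "transformation_monoid \<Omega> M" and fin: "finite \<Omega>"
    and I: "is_minimal_ideal I (monoid_of \<Omega> M)"
    and "x \<in> I" "y \<in> I"
  shows "card (x ` \<Omega>) = card (y ` \<Omega>)"
proof -
  define \<rho> where "\<rho> f = card (f ` \<Omega>)" for f :: "'a \<Rightarrow> 'a"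
  define J where "J = {z \<in> I. \<forall>w\<in>I. \<rho> z \<le> \<rho> w}"
  note ideal = I[unfolded is_minimal_ideal_def two_sided_ideal_def monoid_of_simps]
  have left: "\<rho> (compose \<Omega> m z) \<le> \<rho> z" for m z
  proof -
    have "compose \<Omega> m z ` \<Omega> = m ` (z ` \<Omega>)"
      by (auto simp: compose_def image_iff)
    then show ?thesis
      unfolding \<rho>_def using fin by (simp add: card_image_le)
  qed
  have right: "\<rho> (compose \<Omega> z m) \<le> \<rho> z" if "m \<in> M" for m z
  proof -
    have "compose \<Omega> z m ` \<Omega> \<subseteq> z ` \<Omega>"
      using transformation_monoidD(2)[OF M] that by (auto simp: compose_def)
    then show ?thesis
      unfolding \<rho>_def using fin by (simp add: card_mono)
  qed
  have "J \<noteq> {}"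
  proof -
    obtain z where "z \<in> I" "\<And>w. w \<in> I \<Longrightarrow> \<rho> z \<le> \<rho> w"
      using ex_has_least_nat[of "\<lambda>z. z \<in> I" x \<rho>] \<open>x \<in> I\<close> by blast
    then show ?thesis by (auto simp: J_def)
  qed
  moreover have "compose \<Omega> m z \<in> J \<and> compose \<Omega> z m \<in> J" if "z \<in> J" "m \<in> M" for z m
  proof -
    have "compose \<Omega> m z \<in> I" "compose \<Omega> z m \<in> I"
      using ideal that by (auto simp: J_def)
    then show ?thesis
      using left[of m z] right[OF that(2), of z] that(1) order_trans
      unfolding J_def by blast
  qed
  moreover have "J \<subseteq> I" by (auto simp: J_def)
  moreover have "I \<subseteq> M" using ideal by blast
  ultimately have "two_sided_ideal J (monoid_of \<Omega> M)"
    unfolding two_sided_ideal_def monoid_of_simps by simp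
  then have "J = I"
    using I \<open>J \<subseteq> I\<close> by (simp add: is_minimal_ideal_def)
  then have "\<rho> x = \<rho> y"
    using \<open>x \<in> I\<close> \<open>y \<in> I\<close> unfolding J_def by (intro antisym) blast+
  then show ?thesis by (simp add: \<rho>_def)
qed

text \<open>As \<open>sms\<close> and \<open>s\<close> have the same finite rank, \<open>\<omega> \<mapsto> \<omega>ms\<close> maps \<open>\<Omega>s\<close> bijectively onto itself.
  The sum counts the preimages of \<open>\<beta>\<close> under this bijection.\<close>

lemma image_translate_meets_block_once:
  assumes M: "transformation_monoid \<Omega> M" and fin: "finite \<Omega>"
    and s: "s \<in> minimal_ideal (monoid_of \<Omega> M)"
    and m: "m \<in> M" and \<beta>: "\<beta> \<in> s ` \<Omega>"
  shows "(\<Sum>t\<in>s ` \<Omega>. indicator {\<omega>\<in>\<Omega>. s \<omega> = \<beta>} (m t)) = (1::real)"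
proof -
  define I where "I = minimal_ideal (monoid_of \<Omega> M)"
  have I: "is_minimal_ideal I (monoid_of \<Omega> M)"
    unfolding I_def
    by (intro is_minimal_ideal_minimal_ideal monoid_monoid_of[OF M] finite_monoid_of[OF M fin])
  note ideal = I[unfolded is_minimal_ideal_def two_sided_ideal_def monoid_of_simps]
  have "s \<in> I" using s by (simp add: I_def)
  then have "s \<in> M" using ideal by blast
  have maps: "f \<omega> \<in> \<Omega>" if "f \<in> M" "\<omega> \<in> \<Omega>" for f \<omega>
    using transformation_monoidD(2)[OF M] that by auto
  have "compose \<Omega> s (compose \<Omega> m s) \<in> I"
    using ideal \<open>s \<in> I\<close> \<open>s \<in> M\<close> m by blast
  then have "card (compose \<Omega> s (compose \<Omega> m s) ` \<Omega>) = card (s ` \<Omega>)"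
    using rank_constant_on_minimal_ideal[OF M fin I] \<open>s \<in> I\<close> by blast
  moreover have "compose \<Omega> s (compose \<Omega> m s) ` \<Omega> = (\<lambda>t. s (m t)) ` (s ` \<Omega>)"
    by (auto simp: compose_def image_iff)
  ultimately have card: "card ((\<lambda>t. s (m t)) ` (s ` \<Omega>)) = card (s ` \<Omega>)"
    by simp
  have inj: "inj_on (\<lambda>t. s (m t)) (s ` \<Omega>)"
    using card fin by (intro eq_card_imp_inj_on) auto
  have "(\<lambda>t. s (m t)) ` (s ` \<Omega>) = s ` \<Omega>"
    using card fin maps m \<open>s \<in> M\<close> by (intro card_subset_eq) auto
  then obtain t where t: "t \<in> s ` \<Omega>" "s (m t) = \<beta>"
    using \<beta> by (metis (no_types, lifting) imageE)
  have "indicator {\<omega>\<in>\<Omega>. s \<omega> = \<beta>} (m u) = (if u = t then 1 else (0::real))"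
    if "u \<in> s ` \<Omega>" for u
    using that t inj maps m \<open>s \<in> M\<close> by (auto simp: indicator_def dest: inj_onD)
  then have "(\<Sum>u\<in>s ` \<Omega>. indicator {\<omega>\<in>\<Omega>. s \<omega> = \<beta>} (m u))
      = (\<Sum>u\<in>s ` \<Omega>. if u = t then 1 else (0::real))"
    by (rule sum.cong[OF refl])
  also have "\<dots> = 1"
    using t(1) fin by simp
  finally show ?thesis .
qed

section \<open>Harmonic functions of the random walk\<close>

text \<open>This is the transition matrix \<open>P\<close> acting on functions, written as a sum over maps instead of
  states: in this form it interacts directly with the translates \<open>Tm\<close>.\<close>

definition averaging :: "('a \<Rightarrow> 'a) set \<Rightarrow> ('a \<Rightarrow> 'a) pmf \<Rightarrow> ('a \<Rightarrow> real) \<Rightarrow> 'a \<Rightarrow> real" where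
  "averaging M \<mu> f \<alpha> = (\<Sum>m\<in>M. pmf \<mu> m * f (m \<alpha>))"

lemma sum_transition_matrix:
  assumes "finite M" "finite \<Omega>" and "\<And>m. m \<in> M \<Longrightarrow> m \<alpha> \<in> \<Omega>"
  shows "(\<Sum>\<beta>\<in>\<Omega>. transition_matrix M \<mu> \<alpha> \<beta> * f \<beta>) = averaging M \<mu> f \<alpha>"
proof -
  have "(\<Sum>\<beta>\<in>\<Omega>. transition_matrix M \<mu> \<alpha> \<beta> * f \<beta>)
      = (\<Sum>\<beta>\<in>\<Omega>. \<Sum>m | m \<in> M \<and> m \<alpha> = \<beta>. pmf \<mu> m * f (m \<alpha>))"
    by (simp add: transition_matrix_def sum_distrib_right)
  also have "\<dots> = averaging M \<mu> f \<alpha>"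
    unfolding averaging_def using assms by (intro sum.group) auto
  finally show ?thesis .
qed

lemma stationary_averaging:
  assumes "finite M" "finite \<Omega>" and maps: "\<And>m \<omega>. m \<in> M \<Longrightarrow> \<omega> \<in> \<Omega> \<Longrightarrow> m \<omega> \<in> \<Omega>"
    and st: "stationary_distribution \<Omega> (transition_matrix M \<mu>) \<pi>"
  shows "(\<Sum>\<omega>\<in>\<Omega>. pmf \<pi> \<omega> * averaging M \<mu> f \<omega>) = (\<Sum>\<omega>\<in>\<Omega>. pmf \<pi> \<omega> * f \<omega>)"
proof -
  have "(\<Sum>\<omega>\<in>\<Omega>. pmf \<pi> \<omega> * averaging M \<mu> f \<omega>)
      = (\<Sum>\<omega>\<in>\<Omega>. \<Sum>\<beta>\<in>\<Omega>. pmf \<pi> \<omega> * transition_matrix M \<mu> \<omega> \<beta> * f \<beta>)"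
    using assms by (simp add: sum_transition_matrix[symmetric] sum_distrib_left mult.assoc)
  also have "\<dots> = (\<Sum>\<beta>\<in>\<Omega>. (\<Sum>\<omega>\<in>\<Omega>. pmf \<pi> \<omega> * transition_matrix M \<mu> \<omega> \<beta>) * f \<beta>)"
    by (subst sum.swap) (simp add: sum_distrib_right)
  also have "\<dots> = (\<Sum>\<omega>\<in>\<Omega>. pmf \<pi> \<omega> * f \<omega>)"
    using st by (simp add: stationary_distribution_def)
  finally show ?thesis .
qed

text \<open>The maps in \<open>M\<close> that preserve \<open>Z\<close> form a submonoid.\<close>

lemma generated_submonoid_preserves:
  assumes M: "transformation_monoid \<Omega> M" and "A \<subseteq> M" and "Z \<subseteq> \<Omega>"
    and A: "\<And>m z. m \<in> A \<Longrightarrow> z \<in> Z \<Longrightarrow> m z \<in> Z"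
    and "m \<in> generated_submonoid (monoid_of \<Omega> M) A" "z \<in> Z"
  shows "m z \<in> Z"
proof -
  have "submonoid {f \<in> M. f ` Z \<subseteq> Z} (monoid_of \<Omega> M)"
  proof
    show "f \<otimes>\<^bsub>monoid_of \<Omega> M\<^esub> g \<in> {f \<in> M. f ` Z \<subseteq> Z}"
      if "f \<in> {f \<in> M. f ` Z \<subseteq> Z}" "g \<in> {f \<in> M. f ` Z \<subseteq> Z}" for f g
      using that transformation_monoidD(4)[OF M, of f g] \<open>Z \<subseteq> \<Omega>\<close>
      by (auto simp: monoid_of_simps compose_def)
    show "\<one>\<^bsub>monoid_of \<Omega> M\<^esub> \<in> {f \<in> M. f ` Z \<subseteq> Z}"
      using transformation_monoidD(3)[OF M] \<open>Z \<subseteq> \<Omega>\<close> by (auto simp: monoid_of_simps)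
  qed (auto simp: monoid_of_simps)
  then have "generated_submonoid (monoid_of \<Omega> M) A \<subseteq> {f \<in> M. f ` Z \<subseteq> Z}"
    unfolding generated_submonoid_def using A \<open>A \<subseteq> M\<close> by (intro hull_minimal) blast+
  then show ?thesis
    using assms(5,6) by blast
qed

text \<open>At a point where \<open>h\<close> attains its maximum, the average of \<open>h\<close> over the successors equals this
  maximum, so every successor is again a maximum point; transitivity reaches all of \<open>\<Omega>\<close>.\<close>

lemma harmonic_imp_constant:
  assumes M: "transformation_monoid \<Omega> M" and fin: "finite \<Omega>" and supp: "set_pmf \<mu> \<subseteq> M"
    and tr: "transitive_maps \<Omega> (generated_submonoid (monoid_of \<Omega> M) (set_pmf \<mu>))"
    and harm: "\<And>\<omega>. \<omega> \<in> \<Omega> \<Longrightarrow> averaging M \<mu> h \<omega> = h \<omega>"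
  shows "\<exists>c. \<forall>\<omega>\<in>\<Omega>. h \<omega> = c"
proof -
  define c where "c = Max (h ` \<Omega>)"
  define Z where "Z = {\<omega> \<in> \<Omega>. h \<omega> = c}"
  have le: "h \<omega> \<le> c" if "\<omega> \<in> \<Omega>" for \<omega>
    using that fin by (simp add: c_def)
  have "c \<in> h ` \<Omega>"
    unfolding c_def using fin transformation_monoidD(1)[OF M] by (intro Max_in) auto
  then obtain z where z: "z \<in> Z" by (auto simp: Z_def)
  have finM: "finite M" by (rule finite_transformation_monoid[OF M fin])
  have maps: "m \<omega> \<in> \<Omega>" if "m \<in> M" "\<omega> \<in> \<Omega>" for m \<omega>
    using transformation_monoidD(2)[OF M] that by auto
  have step: "m \<omega> \<in> Z" if m: "m \<in> set_pmf \<mu>" and \<omega>: "\<omega> \<in> Z" for m \<omega>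
  proof -
    have "\<omega> \<in> \<Omega>" "h \<omega> = c" using \<omega> by (auto simp: Z_def)
    have "(\<Sum>m\<in>M. pmf \<mu> m * (c - h (m \<omega>))) = c * (\<Sum>m\<in>M. pmf \<mu> m) - averaging M \<mu> h \<omega>"
      by (simp add: averaging_def algebra_simps sum_subtractf sum_distrib_left)
    also have "\<dots> = 0"
      using sum_pmf_eq_1[OF finM supp] harm[OF \<open>\<omega> \<in> \<Omega>\<close>] \<open>h \<omega> = c\<close> by simp
    finally have "\<forall>m\<in>M. pmf \<mu> m * (c - h (m \<omega>)) = 0"
      using finM le maps \<open>\<omega> \<in> \<Omega>\<close> by (subst (asm) sum_nonneg_eq_0_iff) auto
    then have "h (m \<omega>) = c"
      using m supp by (auto simp: set_pmf_iff)
    then show ?thesis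
      using m supp maps \<open>\<omega> \<in> \<Omega>\<close> by (auto simp: Z_def)
  qed
  have "h \<omega> = c" if "\<omega> \<in> \<Omega>" for \<omega>
  proof -
    have "z \<in> \<Omega>" using z by (simp add: Z_def)
    then have "\<omega> \<in> (\<lambda>f. f z) ` generated_submonoid (monoid_of \<Omega> M) (set_pmf \<mu>)"
      using tr \<open>\<omega> \<in> \<Omega>\<close> by (simp add: transitive_maps_def)
    then obtain m where m: "m \<in> generated_submonoid (monoid_of \<Omega> M) (set_pmf \<mu>)" "\<omega> = m z"
      by (rule imageE)
    have "Z \<subseteq> \<Omega>" by (auto simp: Z_def)
    then have "m z \<in> Z"
      by (rule generated_submonoid_preserves[OF M supp _ _ m(1) z]) (rule step)
    then have "\<omega> \<in> Z"
      using m(2) by simp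
    then show ?thesis by (simp add: Z_def)
  qed
  then show ?thesis by blast
qed

section \<open>Averages of iterates\<close>

lemma bounded_pointwise_convergent_subsequence:
  fixes a :: "nat \<Rightarrow> 'b \<Rightarrow> real"
  assumes "finite S" and "\<And>n x. x \<in> S \<Longrightarrow> \<bar>a n x\<bar> \<le> K"
  shows "\<exists>\<phi> l. strict_mono (\<phi> :: nat \<Rightarrow> nat) \<and> (\<forall>x\<in>S. (\<lambda>n. a (\<phi> n) x) \<longlonglongrightarrow> l x)"
  using assms
proof (induction S rule: finite_induct)
  case empty
  then show ?case using strict_mono_id by auto
next
  case (insert y S)
  have "\<exists>\<phi> l. strict_mono (\<phi> :: nat \<Rightarrow> nat) \<and> (\<forall>x\<in>S. (\<lambda>n. a (\<phi> n) x) \<longlonglongrightarrow> l x)"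
    using insert.prems by (intro insert.IH) simp
  then obtain \<phi> l where \<phi>: "strict_mono (\<phi> :: nat \<Rightarrow> nat)"
    and l: "\<And>x. x \<in> S \<Longrightarrow> (\<lambda>n. a (\<phi> n) x) \<longlonglongrightarrow> l x"
    by blast
  have "bounded (range (\<lambda>n. a (\<phi> n) y))"
    using insert.prems[of y] by (auto simp: bounded_iff)
  then obtain l' \<psi> where \<psi>: "strict_mono (\<psi> :: nat \<Rightarrow> nat)"
    and l': "((\<lambda>n. a (\<phi> n) y) \<circ> \<psi>) \<longlonglongrightarrow> l'"
    using bounded_imp_convergent_subsequence by blast
  have "(\<lambda>n. a ((\<phi> \<circ> \<psi>) n) x) \<longlonglongrightarrow> (l(y := l')) x" if "x \<in> insert y S" for x
    using l' LIMSEQ_subseq_LIMSEQ[OF l \<psi>] that by (auto simp: o_def)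
  moreover have "strict_mono (\<phi> \<circ> \<psi>)"
    using \<phi> \<psi> by (rule strict_mono_o)
  ultimately show ?case by blast
qed

definition cesaro :: "(nat \<Rightarrow> 'a \<Rightarrow> real) \<Rightarrow> nat \<Rightarrow> 'a \<Rightarrow> real" where
  "cesaro F n x = (\<Sum>k\<le>n. F k x) / real (Suc n)"

text \<open>A linear functional that is constant along the sequence has the same value on its averages.\<close>

lemma sum_cesaro_const:
  assumes "\<And>k. (\<Sum>x\<in>S. w x * F k x) = d"
  shows "(\<Sum>x\<in>S. w x * cesaro F n x) = d"
proof -
  have "(\<Sum>x\<in>S. w x * cesaro F n x) = (\<Sum>k\<le>n. \<Sum>x\<in>S. w x * F k x) / real (Suc n)"
    unfolding cesaro_def
    by (subst sum.swap) (simp add: sum_distrib_left sum_divide_distrib del: of_nat_Suc)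
  then show ?thesis
    using assms by (simp del: of_nat_Suc)
qed

text \<open>Applying \<open>P\<close> to the average of the first \<open>n + 1\<close> iterates changes only the two end terms of the
  sum, an error of order \<open>1 / (n + 1)\<close>. Hence any accumulation point of the averages is fixed by
  \<open>P\<close>; accumulation points exist because \<open>\<Omega>\<close> is finite.\<close>

lemma cesaro_averages_accumulate_at_harmonic:
  assumes "finite M" "finite \<Omega>" and maps: "\<And>m \<omega>. m \<in> M \<Longrightarrow> \<omega> \<in> \<Omega> \<Longrightarrow> m \<omega> \<in> \<Omega>"
    and bound: "\<And>k \<omega>. \<omega> \<in> \<Omega> \<Longrightarrow> \<bar>F k \<omega>\<bar> \<le> K"
    and step: "\<And>k. F (Suc k) = averaging M \<mu> (F k)"
  obtains \<phi> h where "strict_mono (\<phi> :: nat \<Rightarrow> nat)"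
    and "\<And>\<omega>. \<omega> \<in> \<Omega> \<Longrightarrow> (\<lambda>n. cesaro F (\<phi> n) \<omega>) \<longlonglongrightarrow> h \<omega>"
    and "\<And>\<omega>. \<omega> \<in> \<Omega> \<Longrightarrow> averaging M \<mu> h \<omega> = h \<omega>"
proof -
  have bound_c: "\<bar>cesaro F n \<omega>\<bar> \<le> K" if "\<omega> \<in> \<Omega>" for n \<omega>
  proof -
    have "\<bar>\<Sum>k\<le>n. F k \<omega>\<bar> \<le> (\<Sum>k\<le>n. \<bar>F k \<omega>\<bar>)" by (rule sum_abs)
    also have "\<dots> \<le> real (Suc n) * K"
      using sum_bounded_above[of "{..n}" "\<lambda>k. \<bar>F k \<omega>\<bar>" K] bound[OF that] by simp
    finally show ?thesis
      by (simp add: cesaro_def abs_divide pos_divide_le_eq mult.commute del: of_nat_Suc)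
  qed
  obtain \<phi> h where \<phi>: "strict_mono (\<phi> :: nat \<Rightarrow> nat)"
    and h: "\<And>\<omega>. \<omega> \<in> \<Omega> \<Longrightarrow> (\<lambda>n. cesaro F (\<phi> n) \<omega>) \<longlonglongrightarrow> h \<omega>"
    using bounded_pointwise_convergent_subsequence[of \<Omega> "cesaro F" K] bound_c \<open>finite \<Omega>\<close> by blast
  have "averaging M \<mu> h \<omega> = h \<omega>" if \<omega>: "\<omega> \<in> \<Omega>" for \<omega>
  proof -
    have defect: "averaging M \<mu> (cesaro F n) \<omega> - cesaro F n \<omega>
        = (F (Suc n) \<omega> - F 0 \<omega>) / real (Suc n)" for n
    proof -
      have "averaging M \<mu> (cesaro F n) \<omega> = (\<Sum>k\<le>n. averaging M \<mu> (F k) \<omega>) / real (Suc n)"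
        unfolding cesaro_def averaging_def
        by (subst sum.swap) (simp add: sum_distrib_left sum_divide_distrib del: of_nat_Suc)
      also have "\<dots> = (\<Sum>k\<le>n. F (Suc k) \<omega>) / real (Suc n)"
        by (simp add: step)
      finally have "averaging M \<mu> (cesaro F n) \<omega> - cesaro F n \<omega>
          = (\<Sum>k\<le>n. F (Suc k) \<omega> - F k \<omega>) / real (Suc n)"
        by (simp add: cesaro_def sum_subtractf diff_divide_distrib)
      then show ?thesis
        using sum_lessThan_telescope[of "\<lambda>k. F k \<omega>" "Suc n"] by (simp only: lessThan_Suc_atMost)
    qed
    have "(\<lambda>n. averaging M \<mu> (cesaro F n) \<omega> - cesaro F n \<omega>) \<longlonglongrightarrow> 0"
    proof (rule Lim_null_comparison)
      have "\<bar>F (Suc n) \<omega> - F 0 \<omega>\<bar> \<le> 2 * K" for n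
        using bound[OF \<omega>, of "Suc n"] bound[OF \<omega>, of 0] by linarith
      then show "\<forall>\<^sub>F n in sequentially. norm (averaging M \<mu> (cesaro F n) \<omega> - cesaro F n \<omega>)
          \<le> 2 * K / real (Suc n)"
        by (simp add: defect abs_divide divide_right_mono del: of_nat_Suc)
      show "(\<lambda>n. 2 * K / real (Suc n)) \<longlonglongrightarrow> 0"
        using tendsto_mult_right_zero[OF LIMSEQ_inverse_real_of_nat, of "2 * K"]
        by (simp add: divide_inverse)
    qed
    from LIMSEQ_subseq_LIMSEQ[OF this \<phi>]
    have "(\<lambda>n. averaging M \<mu> (cesaro F (\<phi> n)) \<omega> - cesaro F (\<phi> n) \<omega>) \<longlonglongrightarrow> 0"
      by (simp add: o_def)
    moreover have "(\<lambda>n. averaging M \<mu> (cesaro F (\<phi> n)) \<omega> - cesaro F (\<phi> n) \<omega>)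
        \<longlonglongrightarrow> averaging M \<mu> h \<omega> - h \<omega>"
      unfolding averaging_def using maps \<omega> by (intro tendsto_intros h) auto
    ultimately have "averaging M \<mu> h \<omega> - h \<omega> = 0"
      using LIMSEQ_unique by blast
    then show ?thesis by simp
  qed
  with \<phi> h show thesis using that by blast
qed

section \<open>The measure of a kernel block\<close>

theorem kernel_block_measure:
  assumes M: "transformation_monoid \<Omega> M" and fin: "finite \<Omega>" and supp: "set_pmf \<mu> \<subseteq> M"
    and tr: "transitive_maps \<Omega> (generated_submonoid (monoid_of \<Omega> M) (set_pmf \<mu>))"
    and st: "stationary_distribution \<Omega> (transition_matrix M \<mu>) \<pi>"
    and s: "s \<in> minimal_ideal (monoid_of \<Omega> M)" and C: "C \<in> ker_partition \<Omega> s"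
  shows "real (card (s ` \<Omega>)) * measure_pmf.prob \<pi> C = 1"
proof -
  obtain \<beta> where \<beta>: "\<beta> \<in> s ` \<Omega>" and C_eq: "C = {\<omega>\<in>\<Omega>. s \<omega> = \<beta>}"
    using C by (auto simp: ker_partition_def)
  define F where "F k = (averaging M \<mu> ^^ k) (indicator C)" for k
  have F_Suc: "F (Suc k) = averaging M \<mu> (F k)" for k by (simp add: F_def)
  have finM: "finite M" by (rule finite_transformation_monoid[OF M fin])
  have maps: "m \<omega> \<in> \<Omega>" if "m \<in> M" "\<omega> \<in> \<Omega>" for m \<omega>
    using transformation_monoidD(2)[OF M] that by auto
  have "s \<in> M"
    using s is_minimal_ideal_minimal_ideal[OF monoid_monoid_of[OF M] finite_monoid_of[OF M fin]]
    unfolding is_minimal_ideal_def two_sided_ideal_def monoid_of_simps by blast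
  have sub: "s ` \<Omega> \<subseteq> \<Omega>"
    using maps[OF \<open>s \<in> M\<close>] by blast
  have total: "(\<Sum>m\<in>M. pmf \<mu> m) = 1"
    by (rule sum_pmf_eq_1[OF finM supp])
  have bound: "\<bar>F k \<omega>\<bar> \<le> 1" for k \<omega>
  proof (induction k arbitrary: \<omega>)
    case 0
    then show ?case by (simp add: F_def indicator_def)
  next
    case (Suc k)
    have "\<bar>F (Suc k) \<omega>\<bar> \<le> (\<Sum>m\<in>M. \<bar>pmf \<mu> m * F k (m \<omega>)\<bar>)"
      unfolding F_Suc averaging_def by (rule sum_abs)
    also have "\<dots> \<le> (\<Sum>m\<in>M. pmf \<mu> m)"
      using Suc by (intro sum_mono) (simp add: abs_mult mult_left_le)
    finally show ?case by (simp add: total)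
  qed
  \<comment> \<open>The induction needs all translates of the image, as averaging moves it by every \<open>m \<in> M\<close>.\<close>
  have translate: "(\<Sum>t\<in>s ` \<Omega>. F k (m t)) = 1" if "m \<in> M" for k m
    using that
  proof (induction k arbitrary: m)
    case 0
    then show ?case
      using image_translate_meets_block_once[OF M fin s _ \<beta>] by (simp add: F_def C_eq)
  next
    case (Suc k)
    have "(\<Sum>t\<in>s ` \<Omega>. F (Suc k) (m t)) = (\<Sum>m'\<in>M. pmf \<mu> m' * (\<Sum>t\<in>s ` \<Omega>. F k (m' (m t))))"
      unfolding F_Suc averaging_def by (subst sum.swap) (simp add: sum_distrib_left)
    also have "\<dots> = (\<Sum>m'\<in>M. pmf \<mu> m' * 1)"
    proof (intro sum.cong refl arg_cong2[where f = "(*)"])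
      fix m' assume "m' \<in> M"
      then have "(\<Sum>t\<in>s ` \<Omega>. F k (compose \<Omega> m' m t)) = 1"
        using Suc transformation_monoidD(4)[OF M] by blast
      moreover have "(\<Sum>t\<in>s ` \<Omega>. F k (compose \<Omega> m' m t)) = (\<Sum>t\<in>s ` \<Omega>. F k (m' (m t)))"
        using sub by (intro sum.cong refl) (auto simp: compose_def)
      ultimately show "(\<Sum>t\<in>s ` \<Omega>. F k (m' (m t))) = 1" by simp
    qed
    finally show ?case by (simp add: total)
  qed
  have image_sum: "(\<Sum>t\<in>s ` \<Omega>. 1 * F k t) = 1" for k
  proof -
    have "(\<Sum>t\<in>s ` \<Omega>. 1 * F k t) = (\<Sum>t\<in>s ` \<Omega>. F k (restrict id \<Omega> t))"
      using sub by (intro sum.cong refl) auto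
    then show ?thesis
      using translate[OF transformation_monoidD(3)[OF M], of k] by simp
  qed
  have stationary_sum: "(\<Sum>\<omega>\<in>\<Omega>. pmf \<pi> \<omega> * F k \<omega>) = measure_pmf.prob \<pi> C" for k
  proof (induction k)
    case 0
    have "(\<Sum>\<omega>\<in>\<Omega>. pmf \<pi> \<omega> * indicator C \<omega>) = (\<Sum>\<omega>\<in>C. pmf \<pi> \<omega>)"
      using fin unfolding C_eq by (intro sum.mono_neutral_cong_right) auto
    then show ?case
      using fin by (simp add: F_def measure_measure_pmf_finite C_eq)
  next
    case (Suc k)
    then show ?case
      using stationary_averaging[OF finM fin _ st] maps by (simp add: F_Suc)
  qed
  obtain \<phi> h where "strict_mono (\<phi> :: nat \<Rightarrow> nat)"
    and lim: "\<And>\<omega>. \<omega> \<in> \<Omega> \<Longrightarrow> (\<lambda>n. cesaro F (\<phi> n) \<omega>) \<longlonglongrightarrow> h \<omega>"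
    and harm: "\<And>\<omega>. \<omega> \<in> \<Omega> \<Longrightarrow> averaging M \<mu> h \<omega> = h \<omega>"
    using cesaro_averages_accumulate_at_harmonic[of M \<Omega> F 1 \<mu>, OF finM fin _ bound F_Suc] maps
    by metis
  have pass: "(\<Sum>x\<in>S. w x * h x) = d" if "S \<subseteq> \<Omega>" "\<And>k. (\<Sum>x\<in>S. w x * F k x) = d" for S w d
  proof -
    have "(\<lambda>n. \<Sum>x\<in>S. w x * cesaro F (\<phi> n) x) \<longlonglongrightarrow> (\<Sum>x\<in>S. w x * h x)"
      using that(1) by (intro tendsto_intros lim) auto
    then show ?thesis
      using sum_cesaro_const[of w F S d] that(2) by (simp add: LIMSEQ_const_iff)
  qed
  obtain c where c: "\<And>\<omega>. \<omega> \<in> \<Omega> \<Longrightarrow> h \<omega> = c"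
    using harmonic_imp_constant[OF M fin supp tr harm] by blast
  have "(\<Sum>t\<in>s ` \<Omega>. 1 * h t) = real (card (s ` \<Omega>)) * c"
    using c sub by (simp add: subset_iff)
  then have "real (card (s ` \<Omega>)) * c = 1"
    using pass[OF sub image_sum] by simp
  moreover have "(\<Sum>\<omega>\<in>\<Omega>. pmf \<pi> \<omega> * h \<omega>) = (\<Sum>\<omega>\<in>\<Omega>. pmf \<pi> \<omega>) * c"
    using c by (simp add: sum_distrib_right)
  then have "c = measure_pmf.prob \<pi> C"
    using pass[OF order_refl stationary_sum] sum_pmf_eq_1[OF fin, of \<pi>] st
    by (simp add: stationary_distribution_def)
  ultimately show ?thesis by simp
qed

lemma partition_on_ker_partition: "partition_on \<Omega> (ker_partition \<Omega> s)"
proof (rule partition_onI)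
  show "\<Union> (ker_partition \<Omega> s) = \<Omega>"
    by (auto simp: ker_partition_def)
  show "disjnt C D" if "C \<in> ker_partition \<Omega> s" "D \<in> ker_partition \<Omega> s" "C \<noteq> D" for C D
    using that by (auto simp: ker_partition_def disjnt_def)
  show "{} \<notin> ker_partition \<Omega> s"
    by (auto simp: ker_partition_def)
qed

theorem theorem10p4:
  fixes \<Omega> :: "'a set"
    and M :: "('a \<Rightarrow> 'a) set"
    and \<mu> :: "('a \<Rightarrow> 'a) pmf"
    and \<pi> :: "'a pmf"
    and s :: "'a \<Rightarrow> 'a"
    and B :: "nat \<Rightarrow> 'a set"
    and r :: nat
  assumes "transformation_monoid \<Omega> M"
    and "finite \<Omega>"
    and "set_pmf \<mu> \<subseteq> M"
    and "transitive_maps \<Omega> (generated_submonoid (monoid_of \<Omega> M) (set_pmf \<mu>))"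
    and "stationary_distribution \<Omega> (transition_matrix M \<mu>) \<pi>"
    and "s \<in> minimal_ideal (monoid_of \<Omega> M)"
    and "ker_partition \<Omega> s = B ` {1..r}"
  shows "(\<forall>i\<in>{1..r}. real (card (s ` \<Omega>)) * measure_pmf.prob \<pi> (B i) = 1)
    \<and> uniform_partition \<Omega> \<pi> (ker_partition \<Omega> s)"
proof -
  note block = kernel_block_measure[OF assms(1-6)]
  have "measure_pmf.prob \<pi> C = measure_pmf.prob \<pi> D"
    if "C \<in> ker_partition \<Omega> s" "D \<in> ker_partition \<Omega> s" for C D
    using block[OF that(1)] block[OF that(2)] by (metis mult_left_cancel mult_zero_left zero_neq_one)
  then show ?thesis
    using block assms(7) partition_on_ker_partition unfolding uniform_partition_def by blast
qed

end
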